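(* Suppose that $x_0\in\mathcal{F}$ and that the following feasibility assumption holds: for all $i\in\{1,\dots,N\}$, the quadratic program defining $S_\alpha^i(x_i,y_{\mathcal{N}_i},z_{\mathcal{N}_i})$ is feasible for all $(x_i,y_{\mathcal{N}_i},z_{\mathcal{N}_i})\in\Pi_{x_i}\mathcal{F}\times\Pi_{y_{\mathcal{N}_i}}\bar{\mathcal{Y}}\times\Pi_{z_{\mathcal{N}_i}}\bar{\mathcal{Z}}$. Then the trajectories of the SP-SGF system with initial condition $p_0=(v_0,y_0,z_0,\lambda_0,\mu_0,x_0)\in\mathcal{P}$ satisfy $\psi_x(t;p_0)\in\mathcal{F}$ for all $t\ge0$.
   Context: $\mathcal{G}$ is a connected undirected graph with vertex set $\{1,\dots,N\}$; $\mathcal{N}_i$ is the set of neighbors of node $i$. For each $i\in\{1,\dots,N\}$, $k\in\{1,\dots,p\}$, $l\in\{1,\dots,q\}$: $f_i:\mathbb{R}^n\to\mathbb{R}$ is strongly convex and continuously differentiable with locally Lipschitz derivatives; $g_i^k:\mathbb{R}^n\to\mathbb{R}$ is convex and continuously differentiable with locally Lipschitz derivatives; $h_i^l:\mathbb{R}^n\to\mathbb{R}$ is affine. Write $x=[x_1,\dots,x_N]$ with $x_i\in\mathbb{R}^n$, $y=[y_1,\dots,y_N]$ with $y_i=[y_i^1,\dots,y_i^p]\in\mathbb{R}^p$, $z=[z_1,\dots,z_N]$ with $z_i=[z_i^1,\dots,z_i^q]\in\mathbb{R}^q$; $y_{\mathcal{N}_i}=(y_i,(y_j)_{j\in\mathcal{N}_i})$,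 $z_{\mathcal{N}_i}=(z_i,(z_j)_{j\in\mathcal{N}_i})$. $\Pi_\xi\mathcal{S}$ denotes the projection of a set $\mathcal{S}$ onto the variables $\xi$. Put $g^k(x)=\sum_{i=1}^N g_i^k(x_i)$, $h^l(x)=\sum_{i=1}^N h_i^l(x_i)$ and $\mathcal{F}=\{x\in\mathbb{R}^{nN}: g^k(x)\le 0\ \forall k,\ h^l(x)=0\ \forall l\}$, assumed nonempty. Standing assumption (LICQ): for all $x\in\mathbb{R}^{nN}$, the vectors $\{\nabla g^k(x)\}_{k:\,g^k(x)=0}\cup\{\nabla h^l(x)\}_{1\le l\le q}$ are linearly independent. Fix $\alpha,\epsilon,\tau>0$. For $i\in\{1,\dots,N\}$, $S_\alpha^i(x_i,y_{\mathcal{N}_i},z_{\mathcal{N}_i})$ is the minimizer of $$\min_{\xi_i\in\mathbb{R}^n}\tfrac12\|\xi_i+\nabla f_i(x_i)\|^2\ \text{ s.t. }\ \nabla g_i^k(x_i)^T\xi_i\le-\alpha\Big(g_i^k(x_i)+\sum_{j\in\mathcal{N}_i}(y_i^k-y_j^k)\Big)\ \forall k,\quad \nabla h_i^l(x_i)^T\xi_i=-\alpha\Big(h_i^l(x_i)+\sum_{j\in\mathcal{N}_i}(z_i^l-z_j^l)\Big)\ \forall l.$$ The SP-SGF system is, for $i\in\{1,\dots,N\}$, $k\in\{1,\dots,p\}$, $l\in\{1,\dots,q\}$, with $v_i\in\mathbb{R}^n$, $\lambda_i\in\mathbb{R}^p_{\ge0}$, $\mu_i\in\mathbb{R}^q$,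 $$\tau\dot v_i=-\nabla f_i(v_i)-\sum_{k=1}^p\lambda_i^k\nabla g_i^k(v_i)-\sum_{l=1}^q\mu_i^l\nabla h_i^l(v_i),$$ $$\tau\dot y_i^k=-\epsilon y_i^k-\sum_{j\in\mathcal{N}_i}(\lambda_i^k-\lambda_j^k),\qquad \tau\dot z_i^l=-\epsilon z_i^l-\sum_{j\in\mathcal{N}_i}(\mu_i^l-\mu_j^l),$$ $$\tau\dot\lambda_i^k=\Big[g_i^k(v_i)+\sum_{j\in\mathcal{N}_i}(y_i^k-y_j^k)\Big]^+_{\lambda_i^k},\qquad \tau\dot\mu_i^l=h_i^l(v_i)+\sum_{j\in\mathcal{N}_i}(z_i^l-z_j^l),$$ $$\dot x_i=S_\alpha^i(x_i,y_{\mathcal{N}_i},z_{\mathcal{N}_i}),$$ where $[a]_b^+=a$ if $b>0$ and $[a]_b^+=\max\{0,a\}$ if $b=0$. Initial conditions of $v,y,z,\lambda,\mu$ lie in given compact sets $\mathcal{V},\mathcal{Y},\mathcal{Z},\Lambda,M$ (each a product over agents of compact sets), and $\bar{\mathcal{V}},\bar{\mathcal{Y}},\bar{\mathcal{Z}},\bar\Lambda,\bar M$ are compact sets in which the $v,y,z,\lambda,\mu$ components of all such trajectories remain for all $t\ge0$. Set $\mathcal{P}=\mathcal{V}\times\mathcal{Y}\times\mathcal{Z}\times\Lambda\times M\times\mathcal{F}$. $\psi_x(t;p_0)$ denotes the $x$-component at time $t$ of the solution of the SP-SGF system with initial condition $p_0\in\mathcal{P}$ (the paper treats the system as well-posed under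 the feasibility assumption). *)

theory Defs
  imports "HOL-Analysis.Analysis"
begin

text \<open>Agents are the elements of a finite type \<open>'N\<close>; inequality and equality constraints are
  indexed by finite types \<open>'p\<close> and \<open>'q\<close>; stacked variables such as \<open>x = [x\<^sub>1, \<dots>, x\<^sub>N]\<close> are
  elements of \<open>(real^'n)^'N\<close>, with blocks \<open>x $ i\<close>.\<close>

definition connected_graph :: "('N \<Rightarrow> 'N \<Rightarrow> bool) \<Rightarrow> bool" where
  "connected_graph E \<longleftrightarrow> symp E \<and> irreflp E \<and> (\<forall>i j. E\<^sup>*\<^sup>* i j)"

definition nbrs :: "('N \<Rightarrow> 'N \<Rightarrow> bool) \<Rightarrow> 'N \<Rightarrow> 'N set" where
  "nbrs E i = {j. E i j}"

definition grad :: "('a::real_inner \<Rightarrow> real) \<Rightarrow> 'a \<Rightarrow> 'a" where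
  "grad f x = (THE D. GDERIV f x :> D)"

text \<open>The first argument of \<open>local_lipschitz\<close> is a time domain; the gradient does not depend on
  time.\<close>

definition C1_loc_lipschitz :: "('a::real_inner \<Rightarrow> real) \<Rightarrow> bool" where
  "C1_loc_lipschitz f \<longleftrightarrow> (\<forall>x. \<exists>D. GDERIV f x :> D) \<and> continuous_on UNIV (grad f) \<and>
     local_lipschitz (UNIV :: real set) UNIV (\<lambda>_. grad f)"

definition strongly_convex :: "('a::real_inner \<Rightarrow> real) \<Rightarrow> bool" where
  "strongly_convex f \<longleftrightarrow> (\<exists>m>0. \<forall>x y. \<forall>s\<in>{0..1}.
     f ((1 - s) *\<^sub>R x + s *\<^sub>R y)
       \<le> (1 - s) * f x + s * f y - m / 2 * s * (1 - s) * (norm (x - y))\<^sup>2)"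

definition affine_fun :: "('a::real_inner \<Rightarrow> real) \<Rightarrow> bool" where
  "affine_fun h \<longleftrightarrow> (\<exists>a b. \<forall>x. h x = a \<bullet> x + b)"

text \<open>\<open>g\<^sup>k(x) = \<Sum>\<^sub>i g\<^sub>i\<^sup>k(x\<^sub>i)\<close>; also used for \<open>h\<close>.\<close>

definition agent_sum :: "('N::finite \<Rightarrow> 'k \<Rightarrow> real^'n \<Rightarrow> real) \<Rightarrow> 'k \<Rightarrow> (real^'n)^'N \<Rightarrow> real" where
  "agent_sum g k x = (\<Sum>i\<in>UNIV. g i k (x $ i))"

definition feasible_set ::
  "('N::finite \<Rightarrow> 'p \<Rightarrow> real^'n \<Rightarrow> real) \<Rightarrow> ('N \<Rightarrow> 'q \<Rightarrow> real^'n \<Rightarrow> real) \<Rightarrow> ((real^'n)^'N) set" where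
  "feasible_set g h = {x. (\<forall>k. agent_sum g k x \<le> 0) \<and> (\<forall>l. agent_sum h l x = 0)}"

text \<open>Linear independence is that of the indexed family of gradients, so that two active
  constraints with equal gradients violate the condition.\<close>

definition LICQ ::
  "('N::finite \<Rightarrow> 'p::finite \<Rightarrow> real^'n \<Rightarrow> real) \<Rightarrow> ('N \<Rightarrow> 'q::finite \<Rightarrow> real^'n \<Rightarrow> real) \<Rightarrow> bool" where
  "LICQ g h \<longleftrightarrow> (\<forall>x. \<forall>a b.
     (\<Sum>k\<in>{k. agent_sum g k x = 0}. a k *\<^sub>R grad (agent_sum g k) x)
       + (\<Sum>l\<in>UNIV. b l *\<^sub>R grad (agent_sum h l) x) = 0
     \<longrightarrow> (\<forall>k. agent_sum g k x = 0 \<longrightarrow> a k = 0) \<and> (\<forall>l. b l = 0))"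

text \<open>\<open>y\<^bsub>N\<^sub>i\<^esub>\<close> is the restriction of \<open>j \<mapsto> y\<^sub>j\<close> to the closed neighbourhood of \<open>i\<close>.\<close>

definition nbhd_part :: "('N::finite \<Rightarrow> 'N \<Rightarrow> bool) \<Rightarrow> 'N \<Rightarrow> 'a^'N \<Rightarrow> ('N \<Rightarrow> 'a)" where
  "nbhd_part E i y = restrict (\<lambda>j. y $ j) (insert i (nbrs E i))"

definition qp_feasible ::
  "real \<Rightarrow> ('N::finite \<Rightarrow> 'N \<Rightarrow> bool) \<Rightarrow> ('N \<Rightarrow> 'p::finite \<Rightarrow> real^'n \<Rightarrow> real) \<Rightarrow>
   ('N \<Rightarrow> 'q::finite \<Rightarrow> real^'n \<Rightarrow> real) \<Rightarrow>
   'N \<Rightarrow> real^'n \<Rightarrow> ('N \<Rightarrow> real^'p) \<Rightarrow> ('N \<Rightarrow> real^'q) \<Rightarrow> (real^'n) set" where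
  "qp_feasible \<alpha> E g h i xi yN zN = {\<xi>.
     (\<forall>k. grad (g i k) xi \<bullet> \<xi> \<le> - \<alpha> * (g i k xi + (\<Sum>j\<in>nbrs E i. yN i $ k - yN j $ k))) \<and>
     (\<forall>l. grad (h i l) xi \<bullet> \<xi> = - \<alpha> * (h i l xi + (\<Sum>j\<in>nbrs E i. zN i $ l - zN j $ l)))}"

text \<open>The value is unspecified when \<open>qp_feasible\<close> is empty; there \<open>S_sgf\<close> counts as undefined.\<close>

definition S_sgf ::
  "real \<Rightarrow> ('N::finite \<Rightarrow> 'N \<Rightarrow> bool) \<Rightarrow> ('N \<Rightarrow> real^'n \<Rightarrow> real) \<Rightarrow>
   ('N \<Rightarrow> 'p::finite \<Rightarrow> real^'n \<Rightarrow> real) \<Rightarrow> ('N \<Rightarrow> 'q::finite \<Rightarrow> real^'n \<Rightarrow> real) \<Rightarrow>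
   'N \<Rightarrow> real^'n \<Rightarrow> ('N \<Rightarrow> real^'p) \<Rightarrow> ('N \<Rightarrow> real^'q) \<Rightarrow> real^'n" where
  "S_sgf \<alpha> E f g h i xi yN zN =
     arg_min (\<lambda>\<xi>. 1 / 2 * (norm (\<xi> + grad (f i) xi))\<^sup>2) (\<lambda>\<xi>. \<xi> \<in> qp_feasible \<alpha> E g h i xi yN zN)"

text \<open>\<open>[a]\<^sup>+\<^sub>b\<close>, used only for \<open>b \<ge> 0\<close>.\<close>

definition proj_plus :: "real \<Rightarrow> real \<Rightarrow> real" where
  "proj_plus a b = (if b > 0 then a else max 0 a)"

text \<open>\<open>\<phi>\<close> is locally absolutely continuous on \<open>[0, \<infinity>)\<close> with \<open>\<phi>'(t) = w(t)\<close> for almost every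
  \<open>t \<ge> 0\<close>, in integrated form. Classical differentiability would be too strong a notion of
  solution, since \<open>[a]\<^sup>+\<^sub>b\<close> is discontinuous.\<close>

definition has_ae_derivative :: "(real \<Rightarrow> 'a::euclidean_space) \<Rightarrow> (real \<Rightarrow> 'a) \<Rightarrow> bool" where
  "has_ae_derivative \<phi> w \<longleftrightarrow>
     (\<forall>t\<ge>0. w absolutely_integrable_on {0..t} \<and> (w has_integral (\<phi> t - \<phi> 0)) {0..t})"

text \<open>Global (Caratheodory) solutions of the SP-SGF system. The right-hand side of the \<open>x\<close> equation
  is only defined where the quadratic programs are feasible, so a solution has to stay in that
  domain for almost all times.\<close>

definition sp_sgf_solution ::
  "real \<Rightarrow> real \<Rightarrow> real \<Rightarrow> ('N::finite \<Rightarrow> 'N \<Rightarrow> bool) \<Rightarrow> ('N \<Rightarrow> real^'n \<Rightarrow> real) \<Rightarrow>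
   ('N \<Rightarrow> 'p::finite \<Rightarrow> real^'n \<Rightarrow> real) \<Rightarrow> ('N \<Rightarrow> 'q::finite \<Rightarrow> real^'n \<Rightarrow> real) \<Rightarrow>
   (real \<Rightarrow> (real^'n)^'N) \<Rightarrow> (real \<Rightarrow> (real^'p)^'N) \<Rightarrow> (real \<Rightarrow> (real^'q)^'N) \<Rightarrow>
   (real \<Rightarrow> (real^'p)^'N) \<Rightarrow> (real \<Rightarrow> (real^'q)^'N) \<Rightarrow> (real \<Rightarrow> (real^'n)^'N) \<Rightarrow> bool" where
  "sp_sgf_solution \<alpha> \<epsilon> \<tau> E f g h v y z lam \<mu> x \<longleftrightarrow>
     (\<forall>t\<ge>0. \<forall>i k. 0 \<le> lam t $ i $ k) \<and>
     (\<forall>i. has_ae_derivative (\<lambda>t. v t $ i)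
        (\<lambda>t. (- grad (f i) (v t $ i)
              - (\<Sum>k\<in>UNIV. lam t $ i $ k *\<^sub>R grad (g i k) (v t $ i))
              - (\<Sum>l\<in>UNIV. \<mu> t $ i $ l *\<^sub>R grad (h i l) (v t $ i))) /\<^sub>R \<tau>)) \<and>
     (\<forall>i k. has_ae_derivative (\<lambda>t. y t $ i $ k)
        (\<lambda>t. (- \<epsilon> * y t $ i $ k - (\<Sum>j\<in>nbrs E i. lam t $ i $ k - lam t $ j $ k)) / \<tau>)) \<and>
     (\<forall>i l. has_ae_derivative (\<lambda>t. z t $ i $ l)
        (\<lambda>t. (- \<epsilon> * z t $ i $ l - (\<Sum>j\<in>nbrs E i. \<mu> t $ i $ l - \<mu> t $ j $ l)) / \<tau>)) \<and>
     (\<forall>i k. has_ae_derivative (\<lambda>t. lam t $ i $ k)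
        (\<lambda>t. proj_plus (g i k (v t $ i) + (\<Sum>j\<in>nbrs E i. y t $ i $ k - y t $ j $ k))
               (lam t $ i $ k) / \<tau>)) \<and>
     (\<forall>i l. has_ae_derivative (\<lambda>t. \<mu> t $ i $ l)
        (\<lambda>t. (h i l (v t $ i) + (\<Sum>j\<in>nbrs E i. z t $ i $ l - z t $ j $ l)) / \<tau>)) \<and>
     (\<forall>i. AE t in lebesgue. 0 \<le> t \<longrightarrow>
        qp_feasible \<alpha> E g h i (x t $ i) (nbhd_part E i (y t)) (nbhd_part E i (z t)) \<noteq> {}) \<and>
     (\<forall>i. has_ae_derivative (\<lambda>t. x t $ i)
        (\<lambda>t. S_sgf \<alpha> E f g h i (x t $ i) (nbhd_part E i (y t)) (nbhd_part E i (z t))))"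

definition agent_prod :: "('N::finite \<Rightarrow> 'a set) \<Rightarrow> ('a^'N) set" where
  "agent_prod A = {a. \<forall>i. a $ i \<in> A i}"

definition init_set ::
  "('N::finite \<Rightarrow> (real^'n) set) \<Rightarrow> ('N \<Rightarrow> (real^'p) set) \<Rightarrow> ('N \<Rightarrow> (real^'q) set) \<Rightarrow>
   ('N \<Rightarrow> (real^'p) set) \<Rightarrow> ('N \<Rightarrow> (real^'q) set) \<Rightarrow>
   ('N \<Rightarrow> 'p::finite \<Rightarrow> real^'n \<Rightarrow> real) \<Rightarrow> ('N \<Rightarrow> 'q::finite \<Rightarrow> real^'n \<Rightarrow> real) \<Rightarrow>
   (((real^'n)^'N) \<times> ((real^'p)^'N) \<times> ((real^'q)^'N) \<times> ((real^'p)^'N) \<times> ((real^'q)^'N)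
     \<times> ((real^'n)^'N)) set" where
  "init_set V Y Z \<Lambda> M g h =
     agent_prod V \<times> agent_prod Y \<times> agent_prod Z \<times> agent_prod \<Lambda> \<times> agent_prod M \<times> feasible_set g h"

end

theory Submission
  imports Defs
begin

text \<open>Summing the constraints of the quadratic programs over the agents cancels the disagreement
  terms, since the graph is undirected; hence each aggregate constraint function \<open>\<Phi>(t)\<close>
  satisfies \<open>\<Phi>' \<le> - \<alpha> \<Phi>\<close> along a solution. An equality constraint is treated as two convex
  inequality constraints. As the solution is only absolutely continuous, the chain rule for
  \<open>\<Phi>\<close> is replaced by the tangent inequality for convex functions, which bounds the increment
  of \<open>\<Phi>\<close> over a short interval by the integral of the frozen gradient against \<open>x'\<close>; the error
  vanishes under refinement by uniform continuity.\<close>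

section \<open>Gradients and the tangent inequality\<close>

text \<open>Restriction to the line through \<open>u\<close> and \<open>u'\<close> reduces this to
  the one-variable tangent inequality at 0, evaluated at 1. The gradient sits at \<open>u\<close>,
  so with \<open>u\<close> as the later point of a trajectory the increment is bounded from
  above.\<close>

lemma convex_gderiv_above_tangent:
  fixes f :: "'a::real_inner \<Rightarrow> real"
  assumes convex: "convex_on UNIV f" and D: "GDERIV f u :> D"
  shows "f u - f u' \<le> D \<bullet> (u - u')"
proof -
  define \<phi> where "\<phi> = (\<lambda>s::real. f (u + s *\<^sub>R (u' - u)))"
  have "convex_on UNIV \<phi>"
  proof (rule convex_onI)
    fix t r s :: real assume t: "0 < t" "t < 1"
    have "u + ((1 - t) *\<^sub>R r + t *\<^sub>R s) *\<^sub>R (u' - u)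
      = (1 - t) *\<^sub>R (u + r *\<^sub>R (u' - u)) + t *\<^sub>R (u + s *\<^sub>R (u' - u))"
      by (simp add: algebra_simps)
    then show "\<phi> ((1 - t) *\<^sub>R r + t *\<^sub>R s) \<le> (1 - t) * \<phi> r + t * \<phi> s"
      using convex_onD[OF convex, of t] t by (simp add: \<phi>_def)
  qed simp
  moreover have "(\<phi> has_field_derivative D \<bullet> (u' - u)) (at 0)"
  proof -
    have "(f has_derivative (\<lambda>d. d \<bullet> D)) (at (u + 0 *\<^sub>R (u' - u)))"
      using D by (simp add: gderiv_def)
    moreover have "((\<lambda>s. u + s *\<^sub>R (u' - u)) has_derivative (\<lambda>s. s *\<^sub>R (u' - u))) (at (0::real))"
      by (auto intro!: derivative_eq_intros)
    ultimately have "(\<phi> has_derivative (\<lambda>s. (s *\<^sub>R (u' - u)) \<bullet> D)) (at 0)"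
      unfolding \<phi>_def by (rule has_derivative_compose[rotated])
    then show ?thesis
      by (simp add: has_field_derivative_def inner_commute mult_commute_abs)
  qed
  ultimately have "D \<bullet> (u' - u) * (1 - 0) \<le> \<phi> 1 - \<phi> 0"
    by (intro convex_on_imp_above_tangent[of UNIV]) auto
  then show ?thesis
    by (simp add: \<phi>_def inner_diff_right)
qed

lemma C1_loc_lipschitz_gderiv_grad:
  assumes "C1_loc_lipschitz f"
  shows "GDERIV f x :> grad f x"
proof -
  have "\<exists>D. GDERIV f x :> D"
    using assms by (auto simp: C1_loc_lipschitz_def)
  moreover have "D = D'" if "GDERIV f x :> D" "GDERIV f x :> D'" for D D'
  proof -
    have "(\<lambda>d. d \<bullet> D) = (\<lambda>d. d \<bullet> D')"
      using that unfolding gderiv_def by (rule has_derivative_unique)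
    then show ?thesis
      by (metis vector_eq_ldot)
  qed
  ultimately show ?thesis
    unfolding grad_def by (blast intro: theI)
qed

lemma grad_affine: "grad (\<lambda>x. a \<bullet> x + b) u = a"
  unfolding grad_def
proof (rule the_equality)
  show *: "GDERIV (\<lambda>x. a \<bullet> x + b) u :> a"
    unfolding gderiv_def by (auto intro!: derivative_eq_intros simp: inner_commute)
  fix D assume "GDERIV (\<lambda>x. a \<bullet> x + b) u :> D"
  then have "(\<lambda>d. d \<bullet> D) = (\<lambda>d. d \<bullet> a)"
    using * unfolding gderiv_def by (rule has_derivative_unique)
  then show "D = a"
    by (metis vector_eq_ldot)
qed

section \<open>Integration of almost-everywhere derivatives\<close>

lemma has_ae_derivative_interval:
  assumes "has_ae_derivative \<phi> w" "0 \<le> a" "a \<le> b"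
  shows "w absolutely_integrable_on {a..b}" "(w has_integral (\<phi> b - \<phi> a)) {a..b}"
proof -
  have int: "w absolutely_integrable_on {0..b}" and b: "(w has_integral (\<phi> b - \<phi> 0)) {0..b}"
    and a: "(w has_integral (\<phi> a - \<phi> 0)) {0..a}"
    using assms by (auto simp: has_ae_derivative_def)
  show "w absolutely_integrable_on {a..b}"
    using int by (rule set_integrable_subset) (use assms in auto)
  have "w integrable_on {a..b}"
    using has_integral_integrable[OF b] by (rule integrable_subinterval_real) (use assms in auto)
  moreover have "integral {0..a} w + integral {a..b} w = integral {0..b} w"
    using assms has_integral_integrable[OF b] by (intro Henstock_Kurzweil_Integration.integral_combine)
  ultimately show "(w has_integral (\<phi> b - \<phi> a)) {a..b}"
    using integral_unique[OF a] integral_unique[OF b] by (simp add: has_integral_iff algebra_simps)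
qed

lemma has_ae_derivative_continuous_on:
  assumes "has_ae_derivative \<phi> w"
  shows "continuous_on {0..T} \<phi>"
proof (cases "0 \<le> T")
  case True
  then have "continuous_on {0..T} (\<lambda>t. \<phi> 0 + integral {0..t} w)"
    using has_ae_derivative_interval(2)[OF assms, of 0 T]
    by (intro continuous_intros indefinite_integral_continuous_1) auto
  moreover have "\<phi> 0 + integral {0..t} w = \<phi> t" if "t \<in> {0..T}" for t
    using has_ae_derivative_interval(2)[OF assms, of 0 t] that by (simp add: integral_unique)
  ultimately show ?thesis
    by (rule continuous_on_eq)
qed simp

text \<open>Overwriting \<open>f\<close> by \<open>g\<close> on the negligible exceptional set keeps
  the integral of \<open>f\<close> and makes the comparison pointwise. This form is needed because
  the quadratic programs constrain the velocity only at almost every time.\<close>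

lemma has_integral_le_AE:
  fixes f :: "'a::euclidean_space \<Rightarrow> real"
  assumes "(f has_integral i) S" "(g has_integral j) S"
    and "AE x in lebesgue. x \<in> S \<longrightarrow> f x \<le> g x"
  shows "i \<le> j"
proof -
  obtain N where N: "negligible N" "{x. \<not> (x \<in> S \<longrightarrow> f x \<le> g x)} \<subseteq> N"
    using assms(3) unfolding eventually_ae_filter_negligible by blast
  have "((\<lambda>x. if x \<in> N then g x else f x) has_integral i) S"
    using N(1) _ assms(1) by (rule has_integral_spike) auto
  then show ?thesis
    using assms(2) by (rule has_integral_le) (use N in auto)
qed

section \<open>Decay estimates for absolutely continuous curves\<close>

lemma locally_antimono_imp_le:
  fixes F :: "real \<Rightarrow> real"
  assumes "0 < d" and loc: "\<And>r s. a \<le> r \<Longrightarrow> r \<le> s \<Longrightarrow> s \<le> b \<Longrightarrow> s - r < d \<Longrightarrow> F s \<le> F r"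
    and "a \<le> b"
  shows "F b \<le> F a"
proof -
  \<comment> \<open>Induction on the number of steps back to \<open>a\<close>. Steps have length
    \<open>d / 2\<close> because \<open>loc\<close> requires a length strictly below
    \<open>d\<close>.\<close>
  have *: "F s \<le> F a" if "a \<le> s" "s \<le> b" "s - a \<le> real n * (d / 2)" for n s
    using that
  proof (induction n arbitrary: s)
    case 0
    then show ?case by simp
  next
    case (Suc n)
    let ?r = "max a (s - d / 2)"
    have "F ?r \<le> F a"
      using Suc.prems \<open>0 < d\<close> by (intro Suc.IH) (auto simp: algebra_simps max_def)
    moreover have "F s \<le> F ?r"
      using Suc.prems \<open>0 < d\<close> by (intro loc) (auto simp: max_def)
    ultimately show ?case by simp
  qed
  obtain n where "(b - a) / (d / 2) \<le> real n"
    using real_arch_simple by blast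
  then have "b - a \<le> real n * (d / 2)"
    using \<open>0 < d\<close> by (simp add: field_simps)
  then show ?thesis
    using * \<open>a \<le> b\<close> by blast
qed

text \<open>If \<Phi> were positive at \<open>T\<close>, it would be nonnegative after the last time
  \<open>a\<close> with \<open>\<Phi> a \<le> 0\<close>. The integral over the remaining interval
  would then be nonnegative, so \<open>decay\<close> would give
  \<open>\<Phi> T \<le> \<Phi> a\<close>, a contradiction.\<close>

lemma decay_imp_nonpos:
  fixes \<Phi> :: "real \<Rightarrow> real"
  assumes cont: "continuous_on {0..T} \<Phi>"
    and decay: "\<And>a b. 0 \<le> a \<Longrightarrow> a \<le> b \<Longrightarrow> b \<le> T \<Longrightarrow> \<Phi> b - \<Phi> a \<le> - \<alpha> * integral {a..b} \<Phi>"
    and "0 \<le> \<alpha>" "\<Phi> 0 \<le> 0" "0 \<le> T"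
  shows "\<Phi> T \<le> 0"
proof (rule ccontr)
  assume pos: "\<not> \<Phi> T \<le> 0"
  let ?K = "{s \<in> {0..T}. \<Phi> s \<le> 0}"
  have "closed ?K"
    using cont by (intro continuous_on_closed_Collect_le continuous_intros) auto
  moreover have "bounded ?K"
    by (rule bounded_subset[OF bounded_closed_interval[of 0 T]]) auto
  ultimately have "compact ?K"
    by (simp add: compact_eq_bounded_closed)
  moreover have "0 \<in> ?K"
    using \<open>\<Phi> 0 \<le> 0\<close> \<open>0 \<le> T\<close> by simp
  ultimately obtain a where a: "a \<in> ?K" and max: "\<And>s. s \<in> ?K \<Longrightarrow> s \<le> a"
    using compact_attains_sup[of ?K] by blast
  have ge: "0 \<le> \<Phi> s" if "s \<in> {a<..T}" for s
    using max[of s] that a by force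
  have "0 \<le> integral {a..T} \<Phi>"
  proof -
    have "(\<Phi> has_integral integral {a..T} \<Phi>) {a..T}"
      using a cont by (intro integrable_integral integrable_continuous_interval)
        (auto intro: continuous_on_subset)
    \<comment> \<open>The bound \<open>ge\<close> covers only times after \<open>a\<close>, so the
      single value at \<open>a\<close> is replaced by 0.\<close>
    then have "((\<lambda>s. if s = a then 0 else \<Phi> s) has_integral integral {a..T} \<Phi>) {a..T}"
      by (rule has_integral_spike[OF negligible_sing[of a], rotated]) auto
    then show ?thesis
      by (rule has_integral_nonneg) (use ge in auto)
  qed
  then have "0 \<le> \<alpha> * integral {a..T} \<Phi>"
    using \<open>0 \<le> \<alpha>\<close> by simp
  then have "\<Phi> T \<le> \<Phi> a"
    using decay[of a T] a by auto
  then show False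
    using a pos by auto
qed

text \<open>The field \<open>D\<close> is any continuous one satisfying the tangent inequality. One
  lemma thus serves convex constraints, with \<open>D\<close> the gradient, and affine functions of
  either sign, with \<open>D\<close> constant. Hypothesis \<open>ae\<close> is the decay inequality
  with the formal chain-rule derivative in place of the derivative of the sum.\<close>

lemma aggregate_decay:
  fixes \<phi> :: "'i::finite \<Rightarrow> 'a::euclidean_space \<Rightarrow> real" and D :: "'i \<Rightarrow> 'a \<Rightarrow> 'a"
  assumes tangent: "\<And>i u u'. \<phi> i u - \<phi> i u' \<le> D i u \<bullet> (u - u')"
    and contD: "\<And>i. continuous_on UNIV (D i)" and cont: "\<And>i. continuous_on UNIV (\<phi> i)"
    and x: "\<And>i. has_ae_derivative (x i) (w i)"
    and ae: "AE t in lebesgue. 0 \<le> t \<longrightarrow>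
      (\<Sum>i\<in>UNIV. D i (x i t) \<bullet> w i t) \<le> - \<alpha> * (\<Sum>i\<in>UNIV. \<phi> i (x i t))"
    and "0 \<le> \<alpha>" "0 \<le> T" and init: "(\<Sum>i\<in>UNIV. \<phi> i (x i 0)) \<le> 0"
  shows "(\<Sum>i\<in>UNIV. \<phi> i (x i T)) \<le> 0"
proof -
  define \<Phi> where "\<Phi> = (\<lambda>t. \<Sum>i\<in>UNIV. \<phi> i (x i t))"
  define W where "W = (\<lambda>t. \<Sum>i\<in>UNIV. norm (w i t))"
  have contx: "continuous_on {0..T} (x i)" for i
    using x by (rule has_ae_derivative_continuous_on)
  have cont\<Phi>: "continuous_on {0..T} \<Phi>"
    unfolding \<Phi>_def using contx
    by (intro continuous_intros continuous_on_compose2[OF cont]) auto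
  then have int\<Phi>: "\<Phi> integrable_on {a..b}" if "0 \<le> a" "b \<le> T" for a b
    using that by (intro integrable_continuous_interval) (auto intro: continuous_on_subset)
  have intW: "W integrable_on {a..b}" if "0 \<le> a" "a \<le> b" for a b
    unfolding W_def using has_ae_derivative_interval(1)[OF x that]
    by (intro integrable_sum) (auto simp: absolutely_integrable_on_def)
  \<comment> \<open>The error is proportional to the integral of \<open>W\<close>, so that errors on
    consecutive short intervals add up to the same expression on their union.\<close>
  have short: "\<exists>d>0. \<forall>a b. 0 \<le> a \<longrightarrow> a \<le> b \<longrightarrow> b \<le> T \<longrightarrow> b - a < d \<longrightarrow>
      \<Phi> b - \<Phi> a \<le> - \<alpha> * integral {a..b} \<Phi> + e * integral {a..b} W" if "0 < e" for e
  proof -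
    \<comment> \<open>Stacking the fields into one vector yields a single modulus \<open>d\<close>
      valid for all indices.\<close>
    have "continuous_on {0..T} (\<lambda>t. \<chi> i. D i (x i t))"
      using contx by (intro continuous_intros continuous_on_compose2[OF contD]) auto
    then have "uniformly_continuous_on {0..T} (\<lambda>t. \<chi> i. D i (x i t))"
      by (rule compact_uniformly_continuous) simp
    then obtain d where "0 < d" and d: "\<And>s t. s \<in> {0..T} \<Longrightarrow> t \<in> {0..T} \<Longrightarrow> dist t s < d \<Longrightarrow>
        dist (\<chi> i. D i (x i t)) (\<chi> i. D i (x i s)) < e"
      using \<open>0 < e\<close> unfolding uniformly_continuous_on_def by metis
    have "\<Phi> b - \<Phi> a \<le> - \<alpha> * integral {a..b} \<Phi> + e * integral {a..b} W"
      if ab: "0 \<le> a" "a \<le> b" "b \<le> T" "b - a < d" for a b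
    proof -
      have near: "norm (D i (x i b) - D i (x i s)) \<le> e" if "s \<in> {a..b}" for i s
      proof -
        have "dist (D i (x i b)) (D i (x i s)) \<le> dist (\<chi> i. D i (x i b)) (\<chi> i. D i (x i s))"
          using dist_vec_nth_le[of "\<chi> i. D i (x i b)" i "\<chi> i. D i (x i s)"] by simp
        also have "\<dots> < e"
          using that ab by (intro d) (auto simp: dist_real_def)
        finally show ?thesis
          by (simp add: dist_norm)
      qed
      \<comment> \<open>With \<open>D\<close> frozen at time \<open>b\<close>, the bound is linear
        in the displacement and is therefore the integral of the same expression in
        \<open>w\<close>.\<close>
      have "\<Phi> b - \<Phi> a \<le> (\<Sum>i\<in>UNIV. D i (x i b) \<bullet> (x i b - x i a))"
        unfolding \<Phi>_def sum_subtractf[symmetric] by (intro sum_mono tangent)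
      also have "\<dots> \<le> - \<alpha> * integral {a..b} \<Phi> + e * integral {a..b} W"
      proof (rule has_integral_le_AE)
        show "((\<lambda>s. \<Sum>i\<in>UNIV. D i (x i b) \<bullet> w i s) has_integral
            (\<Sum>i\<in>UNIV. D i (x i b) \<bullet> (x i b - x i a))) {a..b}"
          using has_ae_derivative_interval(2)[OF x ab(1,2)]
          by (intro has_integral_sum has_integral_linear[OF _ bounded_linear_inner_right, unfolded o_def])
            auto
        show "((\<lambda>s. - \<alpha> * \<Phi> s + e * W s) has_integral
            - \<alpha> * integral {a..b} \<Phi> + e * integral {a..b} W) {a..b}"
          using int\<Phi>[of a b] intW[of a b] ab
          by (intro has_integral_add has_integral_mult_right integrable_integral) auto
        show "AE s in lebesgue. s \<in> {a..b} \<longrightarrow>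
            (\<Sum>i\<in>UNIV. D i (x i b) \<bullet> w i s) \<le> - \<alpha> * \<Phi> s + e * W s"
          using ae
        proof eventually_elim
          case (elim s)
          show ?case
          proof
            assume s: "s \<in> {a..b}"
            \<comment> \<open>Unfreezing: \<open>D\<close> is moved from time \<open>b\<close> to
              time \<open>s\<close>, where \<open>ae\<close> applies, at a cost controlled by
              \<open>near\<close>.\<close>
            have "D i (x i b) \<bullet> w i s \<le> D i (x i s) \<bullet> w i s + e * norm (w i s)" for i
            proof -
              have "(D i (x i b) - D i (x i s)) \<bullet> w i s \<le> norm (D i (x i b) - D i (x i s)) * norm (w i s)"
                by (rule norm_cauchy_schwarz)
              also have "\<dots> \<le> e * norm (w i s)"
                using near[OF s] by (rule mult_right_mono) simp
              finally show ?thesis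
                by (simp add: inner_diff_left)
            qed
            then have "(\<Sum>i\<in>UNIV. D i (x i b) \<bullet> w i s) \<le>
                (\<Sum>i\<in>UNIV. D i (x i s) \<bullet> w i s + e * norm (w i s))"
              by (rule sum_mono)
            also have "\<dots> = (\<Sum>i\<in>UNIV. D i (x i s) \<bullet> w i s) + e * W s"
              by (simp add: W_def sum.distrib sum_distrib_left)
            also have "\<dots> \<le> - \<alpha> * \<Phi> s + e * W s"
              using elim s ab by (simp add: \<Phi>_def)
            finally show "(\<Sum>i\<in>UNIV. D i (x i b) \<bullet> w i s) \<le> - \<alpha> * \<Phi> s + e * W s" .
          qed
        qed
      qed
      finally show ?thesis .
    qed
    then show ?thesis
      using \<open>0 < d\<close> by blast
  qed
  have approx: "\<Phi> b - \<Phi> a \<le> - \<alpha> * integral {a..b} \<Phi> + e * integral {a..b} W"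
    if ab: "0 \<le> a" "a \<le> b" "b \<le> T" and "0 < e" for a b e
  proof -
    obtain d where "0 < d" and d: "\<And>r s. 0 \<le> r \<Longrightarrow> r \<le> s \<Longrightarrow> s \<le> T \<Longrightarrow> s - r < d \<Longrightarrow>
        \<Phi> s - \<Phi> r \<le> - \<alpha> * integral {r..s} \<Phi> + e * integral {r..s} W"
      using short[OF \<open>0 < e\<close>] by blast
    \<comment> \<open>By additivity of the integral, the estimate on an interval from
      \<open>r\<close> to \<open>s\<close> says exactly \<open>F s \<le> F r\<close>. The
      restriction to short intervals is then lifted by
      \<open>locally_antimono_imp_le\<close>.\<close>
    define F where "F = (\<lambda>s. \<Phi> s + \<alpha> * integral {a..s} \<Phi> - e * integral {a..s} W)"
    have "F b \<le> F a"
      using \<open>0 < d\<close> _ \<open>a \<le> b\<close>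
    proof (rule locally_antimono_imp_le)
      fix r s assume rs: "a \<le> r" "r \<le> s" "s \<le> b" "s - r < d"
      have "integral {a..r} \<Phi> + integral {r..s} \<Phi> = integral {a..s} \<Phi>"
        "integral {a..r} W + integral {r..s} W = integral {a..s} W"
        using rs ab by (auto intro!: Henstock_Kurzweil_Integration.integral_combine int\<Phi> intW)
      then have "F s - F r = \<Phi> s - \<Phi> r + \<alpha> * integral {r..s} \<Phi> - e * integral {r..s} W"
        by (simp add: F_def algebra_simps flip: distrib_left)
      then show "F s \<le> F r"
        using d[of r s] rs ab by simp
    qed
    then show ?thesis
      by (simp add: F_def)
  qed
  have "\<Phi> b - \<Phi> a \<le> - \<alpha> * integral {a..b} \<Phi>" if ab: "0 \<le> a" "a \<le> b" "b \<le> T" for a b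
  proof (rule field_le_epsilon)
    fix \<eta> :: real assume "0 < \<eta>"
    let ?I = "integral {a..b} W"
    have "0 \<le> ?I"
      using ab intW by (intro integral_nonneg) (auto simp: W_def sum_nonneg)
    \<comment> \<open>The choice \<open>e = \<eta> / (?I + 1)\<close> keeps the total error below
      \<eta>; adding 1 covers the case \<open>?I = 0\<close>.\<close>
    then have "\<eta> / (?I + 1) * ?I \<le> \<eta>"
      using \<open>0 < \<eta>\<close> by (simp add: field_simps)
    moreover have "0 < \<eta> / (?I + 1)"
      using \<open>0 < \<eta>\<close> \<open>0 \<le> ?I\<close> by simp
    ultimately show "\<Phi> b - \<Phi> a \<le> - \<alpha> * integral {a..b} \<Phi> + \<eta>"
      using approx[OF ab, of "\<eta> / (?I + 1)"] by linarith
  qed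
  moreover have "\<Phi> 0 \<le> 0"
    using init by (simp add: \<Phi>_def)
  ultimately have "\<Phi> T \<le> 0"
    using decay_imp_nonpos[OF cont\<Phi> _ \<open>0 \<le> \<alpha>\<close> _ \<open>0 \<le> T\<close>] by blast
  then show ?thesis
    by (simp add: \<Phi>_def)
qed

section \<open>The quadratic programs and the graph\<close>

lemma closed_qp_feasible: "closed (qp_feasible \<alpha> E g h i xi yN zN)"
  unfolding qp_feasible_def
  by (intro closed_Collect_conj closed_Collect_all closed_Collect_le closed_Collect_eq continuous_intros)

text \<open>The value of \<open>arg_min\<close> is known to be feasible only once a minimizer
  exists. The objective is half the squared distance to \<open>- grad (f i) xi\<close>, and a
  nonempty closed set has a point nearest to it.\<close>

lemma S_sgf_feasible:
  assumes "qp_feasible \<alpha> E g h i xi yN zN \<noteq> {}"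
  shows "S_sgf \<alpha> E f g h i xi yN zN \<in> qp_feasible \<alpha> E g h i xi yN zN"
proof -
  obtain u where u: "u \<in> qp_feasible \<alpha> E g h i xi yN zN"
    "\<And>u'. u' \<in> qp_feasible \<alpha> E g h i xi yN zN \<Longrightarrow>
      dist (- grad (f i) xi) u \<le> dist (- grad (f i) xi) u'"
    using distance_attains_inf[OF closed_qp_feasible assms] by metis
  have d: "dist (- grad (f i) xi) u' = norm (u' + grad (f i) xi)" for u'
    by (metis dist_commute dist_norm diff_minus_eq_add)
  show ?thesis
    unfolding S_sgf_def
  proof (rule arg_minI)
    show "u \<in> qp_feasible \<alpha> E g h i xi yN zN"
      by (rule u)
    fix u' assume "u' \<in> qp_feasible \<alpha> E g h i xi yN zN"
    then have "(norm (u + grad (f i) xi))\<^sup>2 \<le> (norm (u' + grad (f i) xi))\<^sup>2"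
      using u(2)[of u'] by (intro power_mono) (simp_all add: d)
    then show "\<not> 1 / 2 * (norm (u' + grad (f i) xi))\<^sup>2 < 1 / 2 * (norm (u + grad (f i) xi))\<^sup>2"
      by linarith
  qed
qed

text \<open>Exchanging the endpoints of every edge preserves the index set, as \<open>E\<close> is
  symmetric, but flips each sign; the sum equals its own negative.\<close>

lemma sum_nbrs_antisym:
  fixes c :: "'N::finite \<Rightarrow> real"
  assumes "symp E"
  shows "(\<Sum>i\<in>UNIV. \<Sum>j\<in>nbrs E i. c i - c j) = 0"
proof -
  let ?S = "\<Sum>i\<in>UNIV. \<Sum>j\<in>nbrs E i. c i - c j"
  have "?S = (\<Sum>j\<in>UNIV. \<Sum>i\<in>nbrs E j. c i - c j)"
  proof -
    have "{i. E i j} = {i. E j i}" for j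
      using sympD[OF assms] by blast
    then show ?thesis
      using sum.swap_restrict[of UNIV UNIV "\<lambda>i j. c i - c j" E] by (simp add: nbrs_def)
  qed
  also have "\<dots> = - ?S"
    by (simp add: sum_negf[symmetric])
  finally show ?thesis
    by simp
qed

text \<open>The constraints of agent \<open>i\<close> read only the indices in its closed
  neighbourhood, where \<open>nbhd_part\<close> agrees with the full vector.\<close>

lemma qp_feasible_nbhd_part:
  assumes "u \<in> qp_feasible \<alpha> E g h i xi (nbhd_part E i y) (nbhd_part E i z)"
  shows "grad (g i k) xi \<bullet> u \<le> - \<alpha> * (g i k xi + (\<Sum>j\<in>nbrs E i. y $ i $ k - y $ j $ k))"
    and "grad (h i l) xi \<bullet> u = - \<alpha> * (h i l xi + (\<Sum>j\<in>nbrs E i. z $ i $ l - z $ j $ l))"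
  using assms by (auto simp: qp_feasible_def nbhd_part_def cong: sum.cong)

section \<open>Forward invariance of the feasible set\<close>

theorem lemmaV1:
  fixes E :: "'N::finite \<Rightarrow> 'N \<Rightarrow> bool"
    and f :: "'N \<Rightarrow> real^'n \<Rightarrow> real"
    and g :: "'N \<Rightarrow> 'p::finite \<Rightarrow> real^'n \<Rightarrow> real"
    and h :: "'N \<Rightarrow> 'q::finite \<Rightarrow> real^'n \<Rightarrow> real"
    and \<alpha> \<epsilon> \<tau> :: real
    and V :: "'N \<Rightarrow> (real^'n) set" and Y :: "'N \<Rightarrow> (real^'p) set" and Z :: "'N \<Rightarrow> (real^'q) set"
    and \<Lambda> :: "'N \<Rightarrow> (real^'p) set" and M :: "'N \<Rightarrow> (real^'q) set"
    and Vbar :: "((real^'n)^'N) set" and Ybar :: "((real^'p)^'N) set" and Zbar :: "((real^'q)^'N) set"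
    and \<Lambda>bar :: "((real^'p)^'N) set" and Mbar :: "((real^'q)^'N) set"
    and v :: "real \<Rightarrow> (real^'n)^'N" and y :: "real \<Rightarrow> (real^'p)^'N" and z :: "real \<Rightarrow> (real^'q)^'N"
    and lam :: "real \<Rightarrow> (real^'p)^'N" and \<mu> :: "real \<Rightarrow> (real^'q)^'N" and x :: "real \<Rightarrow> (real^'n)^'N"
  assumes graph: "connected_graph E"
    and f: "\<And>i. strongly_convex (f i)" "\<And>i. C1_loc_lipschitz (f i)"
    and g: "\<And>i k. convex_on UNIV (g i k)" "\<And>i k. C1_loc_lipschitz (g i k)"
    and h: "\<And>i l. affine_fun (h i l)"
    and nonempty: "feasible_set g h \<noteq> {}"
    and licq: "LICQ g h"
    and params: "\<alpha> > 0" "\<epsilon> > 0" "\<tau> > 0"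
    and init_compact: "\<And>i. compact (V i)" "\<And>i. compact (Y i)" "\<And>i. compact (Z i)"
      "\<And>i. compact (\<Lambda> i)" "\<And>i. compact (M i)"
    and \<Lambda>_nonneg: "\<And>i a k. a \<in> \<Lambda> i \<Longrightarrow> 0 \<le> a $ k"
    and bar_compact: "compact Vbar" "compact Ybar" "compact Zbar" "compact \<Lambda>bar" "compact Mbar"
    and remain: "\<And>v y z lam \<mu> x t. sp_sgf_solution \<alpha> \<epsilon> \<tau> E f g h v y z lam \<mu> x \<Longrightarrow>
      (v 0, y 0, z 0, lam 0, \<mu> 0, x 0) \<in> init_set V Y Z \<Lambda> M g h \<Longrightarrow> 0 \<le> t \<Longrightarrow>
      v t \<in> Vbar \<and> y t \<in> Ybar \<and> z t \<in> Zbar \<and> lam t \<in> \<Lambda>bar \<and> \<mu> t \<in> Mbar"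
    and feasibility: "\<And>i. \<forall>xi \<in> (\<lambda>x. x $ i) ` feasible_set g h.
      \<forall>yN \<in> nbhd_part E i ` Ybar. \<forall>zN \<in> nbhd_part E i ` Zbar.
      qp_feasible \<alpha> E g h i xi yN zN \<noteq> {}"
    and solution: "sp_sgf_solution \<alpha> \<epsilon> \<tau> E f g h v y z lam \<mu> x"
    and init: "(v 0, y 0, z 0, lam 0, \<mu> 0, x 0) \<in> init_set V Y Z \<Lambda> M g h"
  shows "\<forall>t\<ge>0. x t \<in> feasible_set g h"
proof (intro allI impI)
  fix T :: real assume T: "0 \<le> T"
  define w where "w = (\<lambda>i t. S_sgf \<alpha> E f g h i (x t $ i) (nbhd_part E i (y t)) (nbhd_part E i (z t)))"
  have deriv: "has_ae_derivative (\<lambda>t. x t $ i) (w i)" for i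
    using solution unfolding sp_sgf_solution_def w_def by blast
  have "AE t in lebesgue. 0 \<le> t \<longrightarrow>
      qp_feasible \<alpha> E g h i (x t $ i) (nbhd_part E i (y t)) (nbhd_part E i (z t)) \<noteq> {}" for i
    using solution unfolding sp_sgf_solution_def by blast
  \<comment> \<open>There are finitely many agents, so their exceptional null sets merge into
    one.\<close>
  then have "AE t in lebesgue. \<forall>i. 0 \<le> t \<longrightarrow>
      qp_feasible \<alpha> E g h i (x t $ i) (nbhd_part E i (y t)) (nbhd_part E i (z t)) \<noteq> {}"
    by (rule eventually_all_finite)
  then have w: "AE t in lebesgue. 0 \<le> t \<longrightarrow>
      (\<forall>i. w i t \<in> qp_feasible \<alpha> E g h i (x t $ i) (nbhd_part E i (y t)) (nbhd_part E i (z t)))"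
    unfolding w_def by eventually_elim (blast intro: S_sgf_feasible)
  have sym: "symp E"
    using graph by (simp add: connected_graph_def)
  have x0: "x 0 \<in> feasible_set g h"
    using init by (simp add: init_set_def)
  \<comment> \<open>The left side is the sum over agents of the right-hand sides of one constraint;
    \<open>c\<close> will be a fixed component of \<open>y t\<close> or \<open>z t\<close>.\<close>
  have cancel: "(\<Sum>i\<in>UNIV. - \<alpha> * (\<phi> i + (\<Sum>j\<in>nbrs E i. c i - c j))) = - \<alpha> * (\<Sum>i\<in>UNIV. \<phi> i)"
    for \<phi> c :: "'N \<Rightarrow> real"
    using sum_nbrs_antisym[OF sym, of c]
    by (simp add: sum.distrib distrib_left sum_negf sum_subtractf flip: sum_distrib_left)
  have "agent_sum g k (x T) \<le> 0" for k
    unfolding agent_sum_def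
  proof (rule aggregate_decay[where D = "\<lambda>i. grad (g i k)" and w = w and \<alpha> = \<alpha>])
    show "g i k u - g i k u' \<le> grad (g i k) u \<bullet> (u - u')" for i u u'
      using g by (intro convex_gderiv_above_tangent C1_loc_lipschitz_gderiv_grad)
    show "continuous_on UNIV (grad (g i k))" for i
      using g(2) by (simp add: C1_loc_lipschitz_def)
    show "continuous_on UNIV (g i k)" for i
      using C1_loc_lipschitz_gderiv_grad[OF g(2)] unfolding gderiv_def
      by (intro has_derivative_continuous_on[of UNIV]) auto
    show "AE t in lebesgue. 0 \<le> t \<longrightarrow>
        (\<Sum>i\<in>UNIV. grad (g i k) (x t $ i) \<bullet> w i t) \<le> - \<alpha> * (\<Sum>i\<in>UNIV. g i k (x t $ i))"
      using w
    proof eventually_elim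
      case (elim t)
      show ?case
      proof
        assume "0 \<le> t"
        then have "(\<Sum>i\<in>UNIV. grad (g i k) (x t $ i) \<bullet> w i t) \<le>
            (\<Sum>i\<in>UNIV. - \<alpha> * (g i k (x t $ i) + (\<Sum>j\<in>nbrs E i. y t $ i $ k - y t $ j $ k)))"
          using elim by (intro sum_mono qp_feasible_nbhd_part(1)) auto
        also have "\<dots> = - \<alpha> * (\<Sum>i\<in>UNIV. g i k (x t $ i))"
          by (rule cancel)
        finally show "(\<Sum>i\<in>UNIV. grad (g i k) (x t $ i) \<bullet> w i t) \<le> - \<alpha> * (\<Sum>i\<in>UNIV. g i k (x t $ i))" .
      qed
    qed
    show "(\<Sum>i\<in>UNIV. g i k (x 0 $ i)) \<le> 0"
      using x0 by (simp add: feasible_set_def agent_sum_def)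
  qed (use deriv T params in auto)
  moreover have "agent_sum h l (x T) = 0" for l
  proof -
    have "\<exists>a b. h i l = (\<lambda>u. a \<bullet> u + b)" for i
      using h[of i l] unfolding affine_fun_def by blast
    then obtain a b where hab: "\<And>i. h i l = (\<lambda>u. a i \<bullet> u + b i)"
      by metis
    \<comment> \<open>An affine function meets the tangent inequality with equality, so any real
      factor \<sigma> is admissible; the values 1 and -1 give the two halves of the equality
      constraint.\<close>
    have sgn: "(\<Sum>i\<in>UNIV. \<sigma> * h i l (x T $ i)) \<le> 0" for \<sigma>
    proof (rule aggregate_decay[where D = "\<lambda>i u. \<sigma> *\<^sub>R a i" and w = w and \<alpha> = \<alpha>])
      show "\<sigma> * h i l u - \<sigma> * h i l u' \<le> \<sigma> *\<^sub>R a i \<bullet> (u - u')" for i u u'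
        by (simp add: hab algebra_simps)
      show "continuous_on UNIV (\<lambda>u. \<sigma> * h i l u)" for i
        unfolding hab by (intro continuous_intros)
      show "AE t in lebesgue. 0 \<le> t \<longrightarrow>
          (\<Sum>i\<in>UNIV. \<sigma> *\<^sub>R a i \<bullet> w i t) \<le> - \<alpha> * (\<Sum>i\<in>UNIV. \<sigma> * h i l (x t $ i))"
        using w
      proof eventually_elim
        case (elim t)
        show ?case
        proof
          assume "0 \<le> t"
          then have "(\<Sum>i\<in>UNIV. grad (h i l) (x t $ i) \<bullet> w i t) =
              (\<Sum>i\<in>UNIV. - \<alpha> * (h i l (x t $ i) + (\<Sum>j\<in>nbrs E i. z t $ i $ l - z t $ j $ l)))"
            using elim by (intro sum.cong qp_feasible_nbhd_part(2)) auto
          also have "\<dots> = - \<alpha> * (\<Sum>i\<in>UNIV. h i l (x t $ i))"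
            by (rule cancel)
          \<comment> \<open>Having an equality here is what allows multiplication by \<sigma> of
            either sign.\<close>
          finally have "(\<Sum>i\<in>UNIV. a i \<bullet> w i t) = - \<alpha> * (\<Sum>i\<in>UNIV. h i l (x t $ i))"
            by (simp add: hab grad_affine)
          then show "(\<Sum>i\<in>UNIV. \<sigma> *\<^sub>R a i \<bullet> w i t) \<le> - \<alpha> * (\<Sum>i\<in>UNIV. \<sigma> * h i l (x t $ i))"
            by (simp flip: sum_distrib_left)
        qed
      qed
      show "(\<Sum>i\<in>UNIV. \<sigma> * h i l (x 0 $ i)) \<le> 0"
        using x0 by (simp add: feasible_set_def agent_sum_def flip: sum_distrib_left)
    qed (use deriv T params in auto)
    then show ?thesis
      using sgn[of 1] sgn[of "- 1"] by (simp add: agent_sum_def sum_negf)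
  qed
  ultimately show "x T \<in> feasible_set g h"
    by (simp add: feasible_set_def)
qed

end
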